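(* Let $\phi$ be the 2-dimensional morphism described in the context and let $x$ be the configuration fixed by $\phi^2$, $x = \lim_{k \rightarrow +\infty}\phi^{2k}(s)$ for the seed $s=\left(\begin{smallmatrix}8 & 12\\1 & 6\end{smallmatrix}\right)$. Then there exists a deterministic finite automaton with output $\mathcal{A}$ such that $x_{\boldsymbol{n}} = \mathcal{A}(\mathrm{rep}_{\mathcal{F}}(\boldsymbol{n}))$ for all $\boldsymbol{n}\in\mathbb{Z}^2$.
   Context: Fibonacci numbers: $F_0=1,F_1=1,F_2=2$, $F_{n+2}=F_{n+1}+F_n$. Let $\Sigma=\{0,1\}$. For an odd-length word $w=w_{2k+1}w_{2k}\cdots w_1\in\Sigma^{2k+1}$ set $\mathrm{val}_\mathcal{F}(w)=\sum_{i=1}^{2k}w_iF_i-w_{2k+1}F_{2k}$. For $n\in\mathbb{Z}$, $\mathrm{rep}_\mathcal{F}(n)$ is the unique odd-length word $w\in\Sigma(\Sigma\Sigma)^*\setminus(\Sigma^*11\Sigma^*\cup000\Sigma^*\cup101\Sigma^* )$ with $\mathrm{val}_\mathcal{F}(w)=n$. For $\boldsymbol{n}=(n_1,n_2)\in\mathbb{Z}^2$, $\mathrm{rep}_\mathcal{F}(\boldsymbol{n})$ is the word over the alphabet of column vectors $\{\binom00,\binom01,\binom10,\binom11\}$ whose top row is $\mathrm{pad}_t(\mathrm{rep}_\mathcal{F}(n_1))$ and bottom row is $\mathrm{pad}_t(\mathrm{rep}_\mathcal{F}(n_2))$, where $t=\max\{|\mathrm{rep}_\mathcal{F}(n_1)|,|\mathrm{rep}_\mathcal{F}(n_2)|\}$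 and $\mathrm{pad}_t(w)=(00)^{(t-|w|)/2}w$ if $w$ starts with $0$, $(10)^{(t-|w|)/2}w$ if $w$ starts with $1$. $\phi$ is the 2-dimensional morphism on $\mathcal{H}=\{0,\dots,15\}$ (2D words written as matrices with Cartesian coordinates, bottom row $=$ row $0$; horizontal dominoes written $(a,b)$ with $a$ at position $(0,0)$): $0\mapsto(14)$, $1\mapsto(13)$, $2\mapsto(12,10)$, $3\mapsto(11,8)$, $4\mapsto(14,7)$, $5\mapsto(13,7)$, $6\mapsto(12,7)$, $7\mapsto\left(\begin{smallmatrix}6\\12\end{smallmatrix}\right)$, $8\mapsto\left(\begin{smallmatrix}3\\14\end{smallmatrix}\right)$, $9\mapsto\left(\begin{smallmatrix}3\\13\end{smallmatrix}\right)$, $10\mapsto\left(\begin{smallmatrix}2\\12\end{smallmatrix}\right)$, $11\mapsto\left(\begin{smallmatrix}6&1\\12&10\end{smallmatrix}\right)$, $12\mapsto\left(\begin{smallmatrix}6&1\\11&8\end{smallmatrix}\right)$, $13\mapsto\left(\begin{smallmatrix}5&1\\15&9\end{smallmatrix}\right)$, $14\mapsto\left(\begin{smallmatrix}4&1\\11&8\end{smallmatrix}\right)$, $15\mapsto\left(\begin{smallmatrix}2&0\\12&7\end{smallmatrix}\right)$. The seed $s$ places one letter in each quadrant: $s_{(-1,0)}=8$, $s_{(0,0)}=12$, $s_{(-1,-1)}=1$, $s_{(0,-1)}=6$; $\phi^2(s)$ prolongates $s$ at the origin, so the limit is a configuration in $\mathcal{H}^{\mathbb{Z}^2}$ fixed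 by $\phi^2$. *)

theory Defs
  imports "HOL-Number_Theory.Fib" "HOL-Library.Sublist"
begin

section \<open>The Fibonacci complement numeration system\<close>

text \<open>The indexing is \<open>F 0 = 1, F 1 = 1, F 2 = 2\<close>, a shift of the library's \<^const>\<open>fib\<close>.\<close>

definition F :: "nat \<Rightarrow> int" where
  "F n = int (fib (Suc n))"

text \<open>Words are lists read from left to right. The letter written \<open>w\<^sub>i\<close> of a word
  \<open>w\<^sub>n \<dots> w\<^sub>1\<close> is therefore \<open>w ! (n - i)\<close>.\<close>

definition val_F :: "nat list \<Rightarrow> int" where
  "val_F w = (\<Sum>i = 1..length w - 1. int (w ! (length w - i)) * F i)
     - int (w ! 0) * F (length w - 1)"

definition rep_words :: "nat list set" where
  "rep_words = {w. set w \<subseteq> {0, 1} \<and> odd (length w) \<and>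
     \<not> sublist [1, 1] w \<and> \<not> prefix [0, 0, 0] w \<and> \<not> prefix [1, 0, 1] w}"

definition rep_F :: "int \<Rightarrow> nat list" where
  "rep_F n = (THE w. w \<in> rep_words \<and> val_F w = n)"

definition pad :: "nat \<Rightarrow> nat list \<Rightarrow> nat list" where
  "pad t w = concat (replicate ((t - length w) div 2) (if hd w = 0 then [0, 0] else [1, 0])) @ w"

text \<open>A letter \<open>(a, b)\<close> stands for the column vector with \<open>a\<close> on top of \<open>b\<close>.\<close>

definition rep_F2 :: "int \<times> int \<Rightarrow> (nat \<times> nat) list" where
  "rep_F2 n =
     (let u = rep_F (fst n); v = rep_F (snd n); t = max (length u) (length v)
      in zip (pad t u) (pad t v))"

section \<open>Two-dimensional words and morphisms\<close>

text \<open>A finite rectangular word is the list of its rows in the order in which a matrix is displayed,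
  top row first. Coordinates are Cartesian, so row \<open>0\<close> is the last one of the list.\<close>

type_synonym 'a word2 = "'a list list"

definition width :: "'a word2 \<Rightarrow> nat" where
  "width m = length (hd m)"

definition height :: "'a word2 \<Rightarrow> nat" where
  "height m = length m"

definition entry :: "'a word2 \<Rightarrow> nat \<Rightarrow> nat \<Rightarrow> 'a" where
  "entry m k l = rev m ! l ! k"

text \<open>A word placed in the plane is a partial function on \<open>\<int>\<^sup>2\<close>. The relation
  \<open>morph_image f u v\<close> says that the image of \<open>u\<close> under the morphism with letter images \<open>f\<close> is
  defined and equal to \<open>v\<close>, with the origin preserved: each letter is replaced by its image, the
  images in one column have the same width, those in one row have the same height, and they are
  concatenated in both directions. \<open>X i\<close> and \<open>Y j\<close> are the coordinates of the left side of
  column \<open>i\<close> and of the bottom side of row \<open>j\<close> in the image.\<close>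

definition morph_image ::
  "('a \<Rightarrow> 'b word2) \<Rightarrow> (int \<times> int \<Rightarrow> 'a option) \<Rightarrow> (int \<times> int \<Rightarrow> 'b option) \<Rightarrow> bool" where
  "morph_image f u v \<longleftrightarrow>
     (\<exists>X Y :: int \<Rightarrow> int. X 0 = 0 \<and> Y 0 = 0 \<and>
        (\<forall>i j a. u (i, j) = Some a \<longrightarrow>
           X (i + 1) - X i = int (width (f a)) \<and> Y (j + 1) - Y j = int (height (f a))) \<and>
        (\<forall>p b. v p = Some b \<longleftrightarrow>
           (\<exists>i j a k l. u (i, j) = Some a \<and> k < width (f a) \<and> l < height (f a) \<and>
              p = (X i + int k, Y j + int l) \<and> b = entry (f a) k l)))"

text \<open>\<open>x\<close> is the limit of the even iterates of \<open>f\<close> on the seed \<open>s\<close>, for pointwise convergence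
  over the discrete alphabet; \<open>W k\<close> is the iterate of order \<open>2 * k\<close>.\<close>

definition even_limit ::
  "('a \<Rightarrow> 'a word2) \<Rightarrow> (int \<times> int \<Rightarrow> 'a option) \<Rightarrow> (int \<times> int \<Rightarrow> 'a) \<Rightarrow> bool" where
  "even_limit f s x \<longleftrightarrow>
     (\<exists>W. (\<forall>k. (morph_image f ^^ (2 * k)) s (W k)) \<and>
          (\<forall>n. eventually (\<lambda>k. W k n = Some (x n)) sequentially))"

section \<open>The morphism and its configuration\<close>

definition H :: "nat set" where
  "H = {0..15}"

definition phi :: "nat \<Rightarrow> nat word2" where
  "phi a =
    [ [[14]],
      [[13]],
      [[12, 10]],
      [[11, 8]],
      [[14, 7]],
      [[13, 7]],
      [[12, 7]],
      [[6],
       [12]],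
      [[3],
       [14]],
      [[3],
       [13]],
      [[2],
       [12]],
      [[6, 1],
       [12, 10]],
      [[6, 1],
       [11, 8]],
      [[5, 1],
       [15, 9]],
      [[4, 1],
       [11, 8]],
      [[2, 0],
       [12, 7]] ] ! a"

definition seed :: "int \<times> int \<Rightarrow> nat option" where
  "seed = [(-1, 0) \<mapsto> 8, (0, 0) \<mapsto> 12, (-1, -1) \<mapsto> 1, (0, -1) \<mapsto> 6]"

definition x_config :: "int \<times> int \<Rightarrow> nat" where
  "x_config = (THE x. even_limit phi seed x)"

section \<open>Deterministic finite automata with output\<close>

record ('q, 'a, 'b) dfao =
  states :: "'q set"
  initial :: 'q
  trans :: "'q \<Rightarrow> 'a \<Rightarrow> 'q"
  out :: "'q \<Rightarrow> 'b"

definition is_dfao :: "'a set \<Rightarrow> 'b set \<Rightarrow> ('q, 'a, 'b) dfao \<Rightarrow> bool" where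
  "is_dfao A B M \<longleftrightarrow>
     finite (states M) \<and> initial M \<in> states M \<and>
     (\<forall>q \<in> states M. \<forall>a \<in> A. trans M q a \<in> states M) \<and>
     (\<forall>q \<in> states M. out M q \<in> B)"

definition dfao_output :: "('q, 'a, 'b) dfao \<Rightarrow> 'a list \<Rightarrow> 'b" where
  "dfao_output M w = out M (foldl (trans M) (initial M) w)"

end

theory Submission
  imports Defs
begin

text \<open>The shape of the image of a letter is a product of two letters of the Fibonacci morphism
  \<open>a \<mapsto> ab\<close>, \<open>b \<mapsto> a\<close>. So the columns of the \<open>m\<close>-th iterate on the seed are addressed by the
  binary words of length \<open>m + 1\<close> without factor \<open>11\<close>: the first digit chooses the seed column
  \<open>0\<close> or \<open>-1\<close>, each further digit chooses a column inside the image of the current one, and the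
  last digit is \<open>1\<close> exactly if the column is narrow. The address of a column evaluates under
  \<^const>\<open>val_F\<close> to its coordinate; the same holds for rows. The automaton therefore takes
  letters as states and reads off the entry of the image that a pair of digits selects. As
  \<open>\<phi>\<^sup>2\<close> prolongs the seed, padding does not change the state reached.\<close>

section \<open>Values of words\<close>

lemma F_rec: "F (Suc (Suc n)) = F (Suc n) + F n"
  by (simp add: F_def)

lemma F_0 [simp]: "F 0 = 1" and F_Suc_0 [simp]: "F (Suc 0) = 1"
  by (simp_all add: F_def)

lemma F_pos: "F n > 0"
  by (simp add: F_def fib_neq_0_nat)

lemma F_ge: "F (Suc n) \<ge> int n"
proof (induction n)
  case (Suc n)
  have "F n > 0" by (rule F_pos)
  with Suc show ?case by (simp add: F_rec)
qed simp

text \<open>Weights count from the right, so over \<open>rev w\<close> appending a digit becomes an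
  index shift; only the leading digit has a negative weight.\<close>

lemma val_F_Cons:
  "val_F (a # w) = (\<Sum>i<length w. int (rev w ! i) * F (Suc i)) - int a * F (length w)"
proof -
  have "(\<Sum>i = 1..length w. int ((a # w) ! (Suc (length w) - i)) * F i)
      = (\<Sum>i<length w. int ((a # w) ! (length w - i)) * F (Suc i))"
    by (rule sum.reindex_bij_witness[of _ Suc "\<lambda>i. i - 1"]) auto
  also have "\<dots> = (\<Sum>i<length w. int (rev w ! i) * F (Suc i))"
    by (intro sum.cong) (auto simp: rev_nth nth_Cons' Suc_diff_Suc)
  finally show ?thesis by (simp add: val_F_def)
qed

lemma val_F_single [simp]: "val_F [a] = - int a"
  by (simp add: val_F_Cons)

text \<open>The recurrence \<open>F_rec\<close> splits every weight, including the negative one; the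
  digit \<open>a\<close> has weight 2 = 1 + 1, whence its extra summand.\<close>

lemma val_F_snoc_snoc:
  assumes "w \<noteq> []"
  shows "val_F (w @ [a, b]) = val_F (w @ [a]) + val_F w + int a + int b"
proof -
  obtain c v where w: "w = c # v" using assms by (cases w) auto
  have F2: "F (Suc (Suc i)) = F (Suc i) + F i" for i by (rule F_rec)
  show ?thesis
    unfolding w append_Cons val_F_Cons
    by (simp add: sum.lessThan_Suc_shift F2 algebra_simps sum.distrib del: sum.lessThan_Suc)
qed

lemma val_F_snoc:
  assumes "w \<noteq> []"
  shows "val_F (w @ [c]) = val_F (w @ [0]) + int c"
proof -
  obtain d v where w: "w = d # v" using assms by (cases w) auto
  show ?thesis
    unfolding w append_Cons val_F_Cons
    by (simp add: sum.lessThan_Suc_shift del: sum.lessThan_Suc)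
qed

text \<open>With \<open>n = length w - 1\<close>, the weight \<open>- F n\<close> of the leading
  digit becomes \<open>F (n + 1) - F (n + 2)\<close>, the same number.\<close>

lemma val_F_pad2:
  assumes "w \<noteq> []"
  shows "val_F (hd w # 0 # w) = val_F w"
proof -
  obtain d v where w: "w = d # v" using assms by (cases w) auto
  show ?thesis
    unfolding w list.sel val_F_Cons by (simp add: nth_append F_rec algebra_simps)
qed

section \<open>Addresses of columns\<close>

text \<open>Lengths of both parities occur because odd iterates are addressed too. The prefixes 000
  and 101 stay allowed: padding produces them.\<close>

definition words :: "nat \<Rightarrow> nat list set" where
  "words m = {w. set w \<subseteq> {0, 1} \<and> length w = Suc m \<and> \<not> sublist [1, 1] w}"

lemma words_not_Nil: "w \<in> words m \<Longrightarrow> w \<noteq> []"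
  by (auto simp: words_def)

lemma sublist_11_snoc:
  assumes "w \<noteq> []"
  shows "sublist [1, 1] (w @ [c]) \<longleftrightarrow> sublist [1, 1] w \<or> (last w = 1 \<and> c = (1 :: nat))"
proof -
  obtain v d where w: "w = v @ [d]" using assms by (cases w rule: rev_cases) auto
  have "w @ [c] = zs @ [1, 1] \<longleftrightarrow> v = zs \<and> d = 1 \<and> c = 1" for zs
    using append1_eq_conv[of "v @ [d]" c "zs @ [1]" 1] by (simp add: w)
  then have "suffix [1, 1] (w @ [c]) \<longleftrightarrow> last w = 1 \<and> c = 1"
    by (simp add: suffix_def w)
  then show ?thesis
    using sublist_snoc[of "[1, 1]" w c] by blast
qed

lemma words_0: "words 0 = {[0], [1]}"
  by (auto simp: words_def length_Suc_conv sublist_code)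

text \<open>One inequality says that \<open>c\<close> is a binary digit and that no 11 arises; it is
  also the bound of \<open>c\<close> by the width \<open>2 - last w\<close> of an image.\<close>

lemma words_snoc:
  "w @ [c] \<in> words (Suc m) \<longleftrightarrow> w \<in> words m \<and> c + last w < 2"
proof (cases "w = []")
  case False
  then have "set w \<subseteq> {0, 1} \<Longrightarrow> last w = 0 \<or> last w = 1"
    using last_in_set[of w] by blast
  with sublist_11_snoc[OF False, of c] show ?thesis by (auto simp: words_def)
qed (simp add: words_def)

lemma words_SucE:
  assumes "u \<in> words (Suc m)"
  obtains w c where "u = w @ [c]" "w \<in> words m" "c + last w < 2"
proof -
  have "u \<noteq> []" using assms by (rule words_not_Nil)
  then obtain w c where "u = w @ [c]" by (cases u rule: rev_cases) auto
  with assms that show thesis by (simp add: words_snoc)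
qed

lemma words_last: "w \<in> words m \<Longrightarrow> last w < 2"
  using last_in_set[of w] by (fastforce simp: words_def)

section \<open>Tilings of the integers by intervals of length 1 and 2\<close>

definition tiling :: "(int \<Rightarrow> int) \<Rightarrow> bool" where
  "tiling X \<longleftrightarrow> X 0 = 0 \<and> (\<forall>i. X (i + 1) - X i \<in> {1, 2})"

definition col :: "(int \<Rightarrow> int) \<Rightarrow> int \<Rightarrow> int" where
  "col X p = (THE i. X i \<le> p \<and> p < X (i + 1))"

lemma tiling_step: "tiling X \<Longrightarrow> X (i + 1) = X i + 1 \<or> X (i + 1) = X i + 2"
  by (auto simp: tiling_def algebra_simps dest: spec[of _ i])

lemma tiling_mono:
  assumes "tiling X" "i \<le> j"
  shows "X i \<le> X j"
  using assms(2)
proof (induction j rule: int_ge_induct)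
  case (step j)
  with tiling_step[OF assms(1), of j] show ?case by linarith
qed simp

lemma tiling_unique:
  assumes "tiling X" "X i \<le> p" "p < X (i + 1)" "X j \<le> p" "p < X (j + 1)"
  shows "i = j"
  using tiling_mono[OF assms(1), of "i + 1" j] tiling_mono[OF assms(1), of "j + 1" i] assms
  by linarith

lemma tiling_ex:
  assumes "tiling X"
  shows "\<exists>i. X i \<le> p \<and> p < X (i + 1)"
proof (induction p rule: int_induct[of _ 0])
  case base
  then show ?case
    using assms tiling_step[OF assms, of 0] by (intro exI[of _ 0]) (auto simp: tiling_def)
next
  case (step1 p)
  then obtain i where "X i \<le> p" "p < X (i + 1)" by blast
  then show ?case
    using tiling_step[OF assms, of "i + 1"]
    by (cases "p + 1 < X (i + 1)") (force intro: exI[of _ i] exI[of _ "i + 1"])+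
next
  case (step2 p)
  then obtain i where "X i \<le> p" "p < X (i + 1)" by blast
  then show ?case
    using tiling_step[OF assms, of "i - 1"]
    by (cases "X i \<le> p - 1") (force intro: exI[of _ i] exI[of _ "i - 1"])+
qed

lemma col_eqI:
  assumes "tiling X" "X i \<le> p" "p < X (i + 1)"
  shows "col X p = i"
  unfolding col_def using assms tiling_unique[OF assms(1)] by blast

lemma col_bounds:
  assumes "tiling X"
  shows "X (col X p) \<le> p" "p < X (col X p + 1)"
  using tiling_ex[OF assms, of p] col_eqI[OF assms] by auto

text \<open>\<open>pos m i\<close> is the coordinate of the left side of the image of column \<open>i\<close> of the
  \<open>m\<close>-th iterate. Beyond the seed the plane is filled up with columns of type \<open>a\<close> on the right
  and \<open>b\<close> on the left, so that no boundary has to be treated. The recursion is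
  \<open>val_F (w @ [c, 0]) = val_F (w @ [c]) + val_F w + c\<close>.\<close>

primrec pos :: "nat \<Rightarrow> int \<Rightarrow> int" where
  "pos 0 = (\<lambda>i. if i \<ge> 0 then 2 * i else i)"
| "pos (Suc m) = (\<lambda>p. 2 * p + col (pos m) p - pos m (col (pos m) p))"

text \<open>The step is 2 minus the offset of \<open>p\<close> in its tile, so a wide tile yields a
  wide and a narrow column and a narrow tile a wide one: the Fibonacci morphism.\<close>

lemma pos_Suc_step:
  assumes "tiling (pos m)"
  shows "pos (Suc m) (p + 1) = pos (Suc m) p + 2 - (p - pos m (col (pos m) p))"
proof -
  define i where "i = col (pos m) p"
  have b: "pos m i \<le> p" "p < pos m (i + 1)"
    using col_bounds[OF assms] by (simp_all add: i_def)
  note st = tiling_step[OF assms, of i] tiling_step[OF assms, of "i + 1"]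
  show ?thesis
  proof (cases "p + 1 < pos m (i + 1)")
    case True
    with b have "col (pos m) (p + 1) = i" by (intro col_eqI assms) auto
    with True b st show ?thesis by (auto simp flip: i_def)
  next
    case False
    with b have e: "pos m (i + 1) = p + 1" by simp
    with st have "col (pos m) (p + 1) = i + 1" by (intro col_eqI assms) auto
    with e show ?thesis by (simp flip: i_def)
  qed
qed

lemma tiling_pos: "tiling (pos m)"
proof (induction m)
  case 0
  show ?case by (auto simp: tiling_def)
next
  case (Suc m)
  have "col (pos m) 0 = 0"
    using Suc tiling_step[OF Suc, of 0] by (intro col_eqI) (auto simp: tiling_def)
  then have "pos (Suc m) 0 = 0" using Suc by (simp add: tiling_def)
  moreover have "pos (Suc m) (p + 1) - pos (Suc m) p \<in> {1, 2}" for p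
    using pos_Suc_step[OF Suc, of p] col_bounds[OF Suc, of p] tiling_step[OF Suc, of "col (pos m) p"]
    by (auto simp del: pos.simps)
  ultimately show ?case unfolding tiling_def by blast
qed

lemma pos_0 [simp]: "pos m 0 = 0"
  using tiling_pos[of m] by (simp add: tiling_def)

text \<open>Both ends are proved together: they enclose \<open>val_F (w @ [c])\<close> in the tile
  of \<open>w\<close>, which identifies its parent column in the next induction step.\<close>

lemma pos_val:
  assumes "w \<in> words m"
  shows "pos m (val_F w) = val_F (w @ [0])"
    and "pos m (val_F w + 1) = val_F (w @ [0]) + 2 - int (last w)"
proof -
  have "pos m (val_F w) = val_F (w @ [0]) \<and>
    pos m (val_F w + 1) = val_F (w @ [0]) + 2 - int (last w)"
    using assms
  proof (induction m arbitrary: w)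
    case 0
    then show ?case by (auto simp: words_0 val_F_Cons)
  next
    case (Suc m)
    from Suc.prems obtain v c where w: "w = v @ [c]" and v: "v \<in> words m" and c: "c + last v < 2"
      by (rule words_SucE)
    have ne: "v \<noteq> []" using v by (rule words_not_Nil)
    note IH = conjunct1[OF Suc.IH[OF v]] conjunct2[OF Suc.IH[OF v]]
    have val: "val_F w = pos m (val_F v) + int c"
      using val_F_snoc[OF ne, of c] IH by (simp add: w)
    have col: "col (pos m) (val_F w) = val_F v"
      using val IH c by (intro col_eqI tiling_pos) auto
    have "val_F (w @ [0]) = val_F w + val_F v + int c"
      using val_F_snoc_snoc[OF ne, of c 0] by (simp add: w)
    moreover have "pos (Suc m) (val_F w) = 2 * val_F w + val_F v - pos m (val_F v)"
      by (simp add: col)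
    moreover have "pos (Suc m) (val_F w + 1) =
        pos (Suc m) (val_F w) + 2 - (val_F w - pos m (val_F v))"
      using pos_Suc_step[OF tiling_pos, of m "val_F w"] unfolding col .
    moreover have "last w = c" by (simp add: w)
    ultimately show ?case using val by linarith
  qed
  then show "pos m (val_F w) = val_F (w @ [0])"
    "pos m (val_F w + 1) = val_F (w @ [0]) + 2 - int (last w)" by blast+
qed

section \<open>Bijection between addresses and coordinates\<close>

lemma val_F_snoc_pos:
  assumes "w \<in> words m"
  shows "val_F (w @ [c]) = pos m (val_F w) + int c"
  using val_F_snoc[OF words_not_Nil[OF assms], of c] pos_val(1)[OF assms] by simp

lemma col_val:
  assumes "w @ [c] \<in> words (Suc m)"
  shows "col (pos m) (val_F (w @ [c])) = val_F w"
proof -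
  from assms have w: "w \<in> words m" and c: "c + last w < 2" by (simp_all add: words_snoc)
  show ?thesis
    using pos_val[OF w] c by (intro col_eqI tiling_pos) (auto simp: val_F_snoc_pos[OF w])
qed

text \<open>The value determines the parent column, hence by induction the prefix; the last digit is
  the offset inside the parent's tile.\<close>

lemma inj_on_val_F: "inj_on val_F (words m)"
proof (induction m)
  case 0
  then show ?case by (simp add: words_0)
next
  case (Suc m)
  show ?case
  proof (rule inj_onI)
    fix u v assume uv: "u \<in> words (Suc m)" "v \<in> words (Suc m)" and eq: "val_F u = val_F v"
    obtain u' c where u: "u = u' @ [c]" "u' \<in> words m" using uv(1) by (rule words_SucE)
    obtain v' d where v: "v = v' @ [d]" "v' \<in> words m" using uv(2) by (rule words_SucE)
    have "val_F u' = val_F v'"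
      using col_val uv eq unfolding u v by metis
    with Suc u v have "u' = v'" by (auto dest: inj_onD)
    with eq u v show "u = v" by (simp add: val_F_snoc_pos)
  qed
qed

text \<open>Each end is a tile boundary, where the offset vanishes and
  \<open>pos (Suc m) p = p + col (pos m) p\<close>, so the ends follow the Fibonacci
  recurrence.\<close>

lemma pos_ends: "pos m (- F m) = - F (Suc m)" "pos m (F (Suc m)) = F (Suc (Suc m))"
proof (induction m)
  case 0
  { case 1 show ?case by simp }
  { case 2 show ?case by (simp add: F_rec) }
next
  case (Suc m)
  { case 1
    have "col (pos m) (- F (Suc m)) = - F m"
      using Suc tiling_step[OF tiling_pos, of m "- F m"] by (intro col_eqI tiling_pos) auto
    with Suc show ?case by (simp add: F_rec) }
  { case 2
    have "col (pos m) (F (Suc (Suc m))) = F (Suc m)"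
      using Suc tiling_step[OF tiling_pos, of m "F (Suc m)"] by (intro col_eqI tiling_pos) auto
    with Suc show ?case by (simp add: F_rec) }
qed

lemma val_F_image: "val_F ` words m = {- F m..<F (Suc m)}"
proof (induction m)
  case 0
  show ?case by (auto simp: words_0)
next
  case (Suc m)
  note mono = tiling_mono[OF tiling_pos[of m]]
  show ?case
  proof (intro equalityI subsetI)
    fix p assume "p \<in> val_F ` words (Suc m)"
    then obtain w c where p: "p = val_F (w @ [c])" and w: "w \<in> words m" and c: "c + last w < 2"
      by (auto elim!: words_SucE)
    have "val_F w \<in> {- F m..<F (Suc m)}" using w Suc by blast
    then have "pos m (- F m) \<le> pos m (val_F w)" "pos m (val_F w + 1) \<le> pos m (F (Suc m))"
      by (auto intro!: mono)
    moreover have "p = pos m (val_F w) + int c"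
      unfolding p using w by (rule val_F_snoc_pos)
    moreover have "pos m (val_F w + 1) = pos m (val_F w) + 2 - int (last w)"
      using pos_val[OF w] by simp
    ultimately show "p \<in> {- F (Suc m)..<F (Suc (Suc m))}"
      unfolding pos_ends using c by simp
  next
    fix p assume p: "p \<in> {- F (Suc m)..<F (Suc (Suc m))}"
    define i where "i = col (pos m) p"
    have b: "pos m i \<le> p" "p < pos m (i + 1)"
      using col_bounds[OF tiling_pos] by (simp_all add: i_def)
    have "- F m \<le> i"
      using mono[of "i + 1" "- F m"] p b pos_ends(1)[of m]
      by (cases "i + 1 \<le> - F m") auto
    moreover have "i < F (Suc m)"
      using mono[of "F (Suc m)" i] p b pos_ends(2)[of m]
      by (cases "F (Suc m) \<le> i") auto
    ultimately have "i \<in> val_F ` words m" unfolding Suc by simp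
    then obtain w where w: "w \<in> words m" "val_F w = i" by blast
    \<comment> \<open>The missing last digit is the offset of \<open>p\<close> in its tile; the tile
      width \<open>2 - last w\<close> makes it admissible.\<close>
    define c where "c = nat (p - pos m i)"
    have "w @ [c] \<in> words (Suc m)"
      using pos_val[OF w(1)] b w words_last[OF w(1)] by (auto simp: words_snoc c_def)
    moreover have "val_F (w @ [c]) = p"
      using w b by (simp add: val_F_snoc_pos c_def)
    ultimately show "p \<in> val_F ` words (Suc m)" by blast
  qed
qed

section \<open>The automaton\<close>

text \<open>State \<open>16\<close> is initial; reading the first pair of digits it branches into the quadrants.\<close>

definition fib_step :: "nat \<Rightarrow> nat \<times> nat \<Rightarrow> nat" where
  "fib_step q = (\<lambda>(a, b).
     if q = 16 then the (seed (if a = 0 then 0 else -1, if b = 0 then 0 else -1))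
     else if a < width (phi q) \<and> b < height (phi q) then entry (phi q) a b
     else 0)"

text \<open>State 16 is no letter, so its output is a placeholder in \<open>H\<close>; no pair of
  binary digits leads back to it.\<close>

definition fib_dfao :: "(nat, nat \<times> nat, nat) dfao" where
  "fib_dfao = \<lparr>states = {0..16}, initial = 16, trans = fib_step,
     out = (\<lambda>q. if q = 16 then 0 else q)\<rparr>"

definition run :: "nat list \<Rightarrow> nat list \<Rightarrow> nat" where
  "run u v = foldl fib_step 16 (zip u v)"

lemma run_snoc: "length u = length v \<Longrightarrow> run (u @ [a]) (v @ [b]) = fib_step (run u v) (a, b)"
  by (simp add: run_def)

lemma fib_step_16 [simp]:
  "fib_step 16 (0, 0) = 12" "fib_step 16 (0, Suc 0) = 6"
  "fib_step 16 (Suc 0, 0) = 8" "fib_step 16 (Suc 0, Suc 0) = 1"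
  by (simp_all add: fib_step_def seed_def)

lemma H_eq_set_upt: "H = set [0..<16]"
  by (auto simp: H_def)

text \<open>A check of the 16 images. Column \<open>k\<close> of an image has width
  \<open>2 - k\<close> whatever the row, and likewise for rows, so the two coordinates evolve
  independently.\<close>

lemma phi_shape:
  assumes "q \<in> H" "k < width (phi q)" "l < height (phi q)"
  shows "entry (phi q) k l \<in> H \<and>
      width (phi (entry (phi q) k l)) = 2 - k \<and> height (phi (entry (phi q) k l)) = 2 - l"
proof -
  have "\<forall>q\<in>set [0..<16]. \<forall>k\<in>set [0..<width (phi q)]. \<forall>l\<in>set [0..<height (phi q)].
    entry (phi q) k l \<in> set [0..<16] \<and>
    width (phi (entry (phi q) k l)) = 2 - k \<and> height (phi (entry (phi q) k l)) = 2 - l"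
    by code_simp
  with assms show ?thesis by (auto simp: H_eq_set_upt)
qed

lemma fib_step_in_H:
  assumes "q \<in> {0..16}" "d \<in> {0, 1} \<times> {0, 1}"
  shows "fib_step q d \<in> H"
proof (cases "q = 16")
  case True
  with assms(2) show ?thesis by (auto simp: H_def)
next
  case False
  with assms(1) have "q \<in> H" by (auto simp: H_def)
  with False show ?thesis
    using phi_shape[of q "fst d" "snd d"] by (cases d) (auto simp: fib_step_def H_def)
qed

lemma is_dfao_fib_dfao: "is_dfao ({0, 1} \<times> {0, 1}) H fib_dfao"
proof -
  have "H \<subseteq> {0..16}" by (auto simp: H_def)
  then have "\<forall>q\<in>{0..16}. \<forall>d\<in>{0, 1} \<times> {0, 1}. fib_step q d \<in> {0..16}"
    using fib_step_in_H by blast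
  moreover have "\<forall>q\<in>{0..16}. (if q = 16 then 0 else q) \<in> H"
    by (auto simp: H_def)
  ultimately show ?thesis by (simp add: is_dfao_def fib_dfao_def)
qed

text \<open>By \<open>phi_shape\<close> the last digits fix the shape of the letter reached, so
  every admissible next pair of digits points into its image and never hits the default of
  \<open>fib_step\<close>.\<close>

lemma run_shape:
  assumes "u \<in> words m" "v \<in> words m"
  shows "run u v \<in> H \<and> width (phi (run u v)) = 2 - last u \<and> height (phi (run u v)) = 2 - last v"
  using assms
proof (induction m arbitrary: u v)
  case 0
  then show ?case by (auto simp: words_0 run_def H_def phi_def width_def height_def)
next
  case (Suc m)
  obtain u' c where u: "u = u' @ [c]" "u' \<in> words m" "c + last u' < 2"
    using Suc.prems(1) by (rule words_SucE)
  obtain v' d where v: "v = v' @ [d]" "v' \<in> words m" "d + last v' < 2"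
    using Suc.prems(2) by (rule words_SucE)
  have IH: "run u' v' \<in> H" "width (phi (run u' v')) = 2 - last u'"
    "height (phi (run u' v')) = 2 - last v'"
    using Suc.IH[OF u(2) v(2)] by blast+
  have "run u v = fib_step (run u' v') (c, d)"
    using u v by (simp add: run_snoc words_def)
  also have "\<dots> = entry (phi (run u' v')) c d"
    using IH u v by (auto simp: fib_step_def H_def)
  finally show ?case
    using phi_shape[OF IH(1), of c d] IH u v by simp
qed

lemma run_snoc_words:
  assumes "u @ [c] \<in> words (Suc m)" "v @ [d] \<in> words (Suc m)"
  shows "run (u @ [c]) (v @ [d]) = entry (phi (run u v)) c d"
proof -
  have uv: "u \<in> words m" "v \<in> words m" "c + last u < 2" "d + last v < 2"
    using assms by (simp_all add: words_snoc)
  then have "length u = length v" by (simp add: words_def)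
  then show ?thesis
    using run_shape[OF uv(1,2)] uv by (auto simp: run_snoc fib_step_def H_def)
qed

section \<open>The iterates of the morphism\<close>

text \<open>An explicit candidate for the iterate: each cell is decoded to its two addresses, unique
  by \<open>inj_on_val_F\<close>, and the automaton reads them.\<close>

definition iterate :: "nat \<Rightarrow> int \<times> int \<Rightarrow> nat option" where
  "iterate m = (\<lambda>(i, j). if i \<in> val_F ` words m \<and> j \<in> val_F ` words m
     then Some (run (inv_into (words m) val_F i) (inv_into (words m) val_F j)) else None)"

lemma iterate_eq_Some:
  "iterate m p = Some b \<longleftrightarrow>
     (\<exists>u\<in>words m. \<exists>v\<in>words m. p = (val_F u, val_F v) \<and> b = run u v)"
proof -
  have "iterate m (val_F u, val_F v) = Some (run u v)" if "u \<in> words m" "v \<in> words m" for u v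
    using that by (simp add: iterate_def inv_into_f_f[OF inj_on_val_F])
  moreover have "\<exists>u\<in>words m. \<exists>v\<in>words m. p = (val_F u, val_F v)" if "iterate m p = Some b"
    using that by (cases p) (auto simp: iterate_def split: if_splits)
  ultimately show ?thesis by fastforce
qed

lemma dom_iterate: "dom (iterate m) = {- F m..<F (Suc m)} \<times> {- F m..<F (Suc m)}"
  unfolding val_F_image[symmetric] by (auto simp: iterate_def split: if_splits)

lemma iterate_0: "iterate 0 = seed"
proof -
  have "iterate 0 p = Some b \<longleftrightarrow> seed p = Some b" for p b
    unfolding iterate_eq_Some by (auto simp: words_0 run_def seed_def)
  then show ?thesis by (metis ext option.exhaust)
qed

lemma morph_image_iterate: "morph_image phi (iterate m) (iterate (Suc m))"
  unfolding morph_image_def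
\<comment> \<open>\<open>pos m\<close> serves columns and rows alike, since widths and heights
  depend on the last digits in the same way.\<close>
proof (intro exI[of _ "pos m"] conjI allI impI)
  fix i j a assume "iterate m (i, j) = Some a"
  then obtain u v where uv: "u \<in> words m" "v \<in> words m" "i = val_F u" "j = val_F v" "a = run u v"
    by (auto simp: iterate_eq_Some)
  show "pos m (i + 1) - pos m i = int (width (phi a))"
    using pos_val[OF uv(1)] words_last[OF uv(1)] run_shape[OF uv(1,2)] uv by simp
  show "pos m (j + 1) - pos m j = int (height (phi a))"
    using pos_val[OF uv(2)] words_last[OF uv(2)] run_shape[OF uv(1,2)] uv by simp
next
  fix p b
  show "iterate (Suc m) p = Some b \<longleftrightarrow>
    (\<exists>i j a k l. iterate m (i, j) = Some a \<and> k < width (phi a) \<and> l < height (phi a) \<and>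
       p = (pos m i + int k, pos m j + int l) \<and> b = entry (phi a) k l)" (is "?L \<longleftrightarrow> ?R")
  proof
    assume ?L
    then obtain u v where u: "u \<in> words (Suc m)" and v: "v \<in> words (Suc m)"
      and p: "p = (val_F u, val_F v)" and b: "b = run u v"
      by (auto simp: iterate_eq_Some)
    obtain u' k where u': "u = u' @ [k]" "u' \<in> words m" "k + last u' < 2"
      using u by (rule words_SucE)
    obtain v' l where v': "v = v' @ [l]" "v' \<in> words m" "l + last v' < 2"
      using v by (rule words_SucE)
    have "iterate m (val_F u', val_F v') = Some (run u' v')"
      using u' v' by (auto simp: iterate_eq_Some)
    moreover have "k < width (phi (run u' v'))" "l < height (phi (run u' v'))"
      using run_shape[OF u'(2) v'(2)] u' v' by auto
    moreover have "p = (pos m (val_F u') + int k, pos m (val_F v') + int l)"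
      using u' v' by (simp add: p val_F_snoc_pos)
    moreover have "b = entry (phi (run u' v')) k l"
      using u v unfolding b u' v' by (rule run_snoc_words)
    ultimately show ?R by blast
  next
    assume ?R
    then obtain u v k l where uv: "u \<in> words m" "v \<in> words m"
      and k: "k < width (phi (run u v))" and l: "l < height (phi (run u v))"
      and p: "p = (pos m (val_F u) + int k, pos m (val_F v) + int l)"
      and b: "b = entry (phi (run u v)) k l"
      by (auto simp: iterate_eq_Some)
    have w: "u @ [k] \<in> words (Suc m)" "v @ [l] \<in> words (Suc m)"
      using k l uv run_shape[OF uv] by (auto simp: words_snoc)
    moreover have "p = (val_F (u @ [k]), val_F (v @ [l]))"
      using uv by (simp add: p val_F_snoc_pos)
    moreover have "b = run (u @ [k]) (v @ [l])"
      using run_snoc_words[OF w] b by simp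
    ultimately show ?L unfolding iterate_eq_Some by blast
  qed
qed simp_all

section \<open>Uniqueness of the image of a rectangle\<close>

lemma eq_on_interval:
  fixes X X' :: "int \<Rightarrow> int"
  assumes "X 0 = X' 0" "\<And>i. i \<in> {a..<b} \<Longrightarrow> X (i + 1) - X i = X' (i + 1) - X' i"
    and "a \<le> 0" "0 \<le> b" "i \<in> {a..b}"
  shows "X i = X' i"
proof -
  have "i \<in> {a..b} \<longrightarrow> X i = X' i"
  proof (induction i rule: int_induct[of _ 0])
    case base
    then show ?case using assms(1) by simp
  next
    case (step1 i)
    then show ?case using assms(2)[of i] assms(3) by auto
  next
    case (step2 i)
    then show ?case using assms(2)[of "i - 1"] assms(4) by auto
  qed
  with assms(5) show ?thesis by blast
qed

text \<open>The rectangle meets row 0 and column 0, whose letters fix the steps of \<open>X\<close>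
  and \<open>Y\<close> from the origin. Beyond the rectangle two choices may differ, but no letter
  is placed there.\<close>

lemma morph_image_unique:
  assumes "morph_image f u v" "morph_image f u v'"
    and dom: "dom u = {a..<b} \<times> {c..<d}" and ord: "a \<le> 0" "0 < b" "c \<le> 0" "0 < d"
  shows "v = v'"
proof -
  obtain X Y where X: "X 0 = 0" "Y 0 = 0"
    "\<And>i j q. u (i, j) = Some q \<Longrightarrow>
       X (i + 1) - X i = int (width (f q)) \<and> Y (j + 1) - Y j = int (height (f q))"
    and v: "\<And>p q. v p = Some q \<longleftrightarrow>
           (\<exists>i j a k l. u (i, j) = Some a \<and> k < width (f a) \<and> l < height (f a) \<and>
              p = (X i + int k, Y j + int l) \<and> q = entry (f a) k l)"
    using assms(1) unfolding morph_image_def by blast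
  obtain X' Y' where X': "X' 0 = 0" "Y' 0 = 0"
    "\<And>i j q. u (i, j) = Some q \<Longrightarrow>
       X' (i + 1) - X' i = int (width (f q)) \<and> Y' (j + 1) - Y' j = int (height (f q))"
    and v': "\<And>p q. v' p = Some q \<longleftrightarrow>
           (\<exists>i j a k l. u (i, j) = Some a \<and> k < width (f a) \<and> l < height (f a) \<and>
              p = (X' i + int k, Y' j + int l) \<and> q = entry (f a) k l)"
    using assms(2) unfolding morph_image_def by blast
  have in_dom: "\<exists>q. u (i, j) = Some q" if "i \<in> {a..<b}" "j \<in> {c..<d}" for i j
    using that dom by blast
  have eqX: "X i = X' i" if "i \<in> {a..<b}" for i
  proof (rule eq_on_interval[of X X' a b])
    show "X (i + 1) - X i = X' (i + 1) - X' i" if "i \<in> {a..<b}" for i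
      using in_dom[OF that, of 0] X(3) X'(3) ord by fastforce
  qed (use X X' ord that in auto)
  have eqY: "Y j = Y' j" if "j \<in> {c..<d}" for j
  proof (rule eq_on_interval[of Y Y' c d])
    show "Y (j + 1) - Y j = Y' (j + 1) - Y' j" if "j \<in> {c..<d}" for j
      using in_dom[OF _ that, of 0] X(3) X'(3) ord by fastforce
  qed (use X X' ord that in auto)
  have eq: "X i = X' i \<and> Y j = Y' j" if "u (i, j) = Some q" for i j q
    using eqX eqY dom that by blast
  have "v p = Some q \<longleftrightarrow> v' p = Some q" for p q
    unfolding v v' using eq by metis
  then show ?thesis by (metis ext option.exhaust)
qed

lemma relpowp_morph_image: "(morph_image phi ^^ m) seed V \<longleftrightarrow> V = iterate m"
proof (induction m arbitrary: V)
  case 0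
  then show ?case by (auto simp: iterate_0)
next
  case (Suc m)
  have "morph_image phi (iterate m) V \<longleftrightarrow> V = iterate (Suc m)"
    using morph_image_unique[OF _ morph_image_iterate dom_iterate, of m V]
      F_pos[of m] F_pos[of "Suc m"] morph_image_iterate by auto
  with Suc show ?case by auto
qed

section \<open>Representations and padding\<close>

lemma pad_eq:
  assumes "w \<in> words (2 * j)"
  shows "pad (Suc (2 * (j + n))) w = concat (replicate n [hd w, 0]) @ w"
proof -
  have "hd w \<in> set w" using assms words_not_Nil by auto
  then have "hd w = 0 \<or> hd w = 1" using assms by (auto simp: words_def)
  with assms show ?thesis by (auto simp: pad_def words_def)
qed

lemma words_pad2:
  assumes "w \<in> words m"
  shows "hd w # 0 # w \<in> words (Suc (Suc m))"
proof -
  obtain d v where "w = d # v" using words_not_Nil[OF assms] by (cases w) auto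
  with assms show ?thesis by (auto simp: words_def sublist_Cons_right)
qed

lemma pad_Suc:
  assumes "w \<in> words (2 * j)"
  shows "pad (Suc (2 * (j + Suc n))) w =
    hd (pad (Suc (2 * (j + n))) w) # 0 # pad (Suc (2 * (j + n))) w"
  unfolding pad_eq[OF assms] by (cases n) auto

lemma pad_words:
  assumes "w \<in> words (2 * j)"
  shows "pad (Suc (2 * (j + n))) w \<in> words (2 * (j + n)) \<and> val_F (pad (Suc (2 * (j + n))) w) = val_F w"
proof (induction n)
  case 0
  then show ?case using assms pad_eq[OF assms, of 0] by simp
next
  case (Suc n)
  then show ?case
    using words_pad2[of "pad (Suc (2 * (j + n))) w" "2 * (j + n)"] val_F_pad2 words_not_Nil
    unfolding pad_Suc[OF assms] by auto
qed

section \<open>Existence and uniqueness of representations\<close>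

lemma rep_words_words:
  "w \<in> rep_words \<longleftrightarrow> (\<exists>j. w \<in> words (2 * j)) \<and> \<not> prefix [0, 0, 0] w \<and> \<not> prefix [1, 0, 1] w"
  by (auto simp: rep_words_def words_def elim: oddE)

text \<open>Padding the shorter word to the length of the longer keeps its value, so injectivity
  makes them equal; a nonempty padding would create the prefix 000 or 101.\<close>

lemma rep_words_unique_le:
  assumes "u \<in> rep_words" "v \<in> rep_words" "val_F u = val_F v" "length u \<le> length v"
  shows "u = v"
proof -
  obtain j k where j: "u \<in> words (2 * j)" and k: "v \<in> words (2 * k)"
    using assms(1,2) by (auto simp: rep_words_words)
  with assms(4) have "j \<le> k" by (auto simp: words_def)
  then obtain n where n: "k = j + n" using le_Suc_ex by blast
  have "pad (Suc (2 * (j + n))) u = v"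
    using pad_words[OF j, of n] k assms(3) inj_on_val_F unfolding n by (metis inj_onD)
  then have v: "v = concat (replicate n [hd u, 0]) @ u" unfolding pad_eq[OF j] by simp
  show ?thesis
  proof (cases n)
    case (Suc n')
    obtain d t where u: "u = d # t" using words_not_Nil[OF j] by (cases u) auto
    have "d = 0 \<or> d = 1" using j by (auto simp: u words_def)
    \<comment> \<open>After the first block comes another block or \<open>u\<close>, and both begin
      with \<open>d\<close>.\<close>
    moreover have "prefix [d, 0, d] v"
      unfolding v Suc u by (cases n') auto
    ultimately show ?thesis using assms(2) by (auto simp: rep_words_words)
  qed (simp add: v)
qed

text \<open>A shortest address of odd length is taken; by \<open>val_F_pad2\<close> one with a
  prefix \<open>d 0 d\<close> could lose two digits.\<close>

lemma rep_words_ex: "\<exists>w\<in>rep_words. val_F w = p"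
proof -
  have ex: "\<exists>j. \<exists>w\<in>words (2 * j). val_F w = p"
  proof -
    \<comment> \<open>Large enough for the linear bound \<open>F_ge\<close> to put \<open>p\<close>
      strictly between \<open>- F (2 * j)\<close> and \<open>F (2 * j)\<close>.\<close>
    define j where "j = Suc (nat \<bar>p\<bar>)"
    have "\<bar>p\<bar> \<le> int (2 * nat \<bar>p\<bar>)" by simp
    also have "\<dots> < F (2 * j)"
      using F_ge[of "Suc (2 * nat \<bar>p\<bar>)"] by (simp add: j_def)
    finally have "\<bar>p\<bar> < F (2 * j)" .
    moreover have "F (2 * j) \<le> F (Suc (2 * j))" using fib_mono by (simp add: F_def)
    ultimately have "p \<in> val_F ` words (2 * j)" by (auto simp: val_F_image)
    then show ?thesis by blast
  qed
  define j where "j = (LEAST j. \<exists>w\<in>words (2 * j). val_F w = p)"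
  have "\<exists>w\<in>words (2 * j). val_F w = p" unfolding j_def using ex by (rule LeastI_ex)
  then obtain w where w: "w \<in> words (2 * j)" "val_F w = p" by blast
  have False if pre: "prefix [d, 0, d] w" for d
  proof -
    obtain v where v: "w = d # 0 # d # v" using pre by (auto simp: prefix_def)
    with w(1) obtain i where i: "j = Suc i" by (cases j) (auto simp: words_def)
    have "d # v \<in> words (2 * i)"
      using w(1) by (auto simp: v i words_def sublist_Cons_right)
    moreover have "val_F (d # v) = p" using val_F_pad2[of "d # v"] w(2) v by simp
    ultimately show False using not_less_Least[of i "\<lambda>j. \<exists>w\<in>words (2 * j). val_F w = p"] i
      by (auto simp flip: j_def)
  qed
  then have "w \<in> rep_words" using w(1) unfolding rep_words_words by blast
  then show ?thesis using w(2) by blast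
qed

lemma rep_F: "rep_F p \<in> rep_words" "val_F (rep_F p) = p"
proof -
  have "\<exists>!w. w \<in> rep_words \<and> val_F w = p"
    using rep_words_ex[of p] rep_words_unique_le by (metis linear)
  from theI'[OF this] show "rep_F p \<in> rep_words" "val_F (rep_F p) = p"
    by (auto simp: rep_F_def)
qed

text \<open>Here \<open>phi\<close> squared prolongs the seed: in each quadrant the digits
  \<open>(0, 0)\<close>, \<open>(c, d)\<close> lead from the seed letter back to itself.\<close>

lemma run_pad2:
  assumes "u \<in> words m" "v \<in> words m"
  shows "run (hd u # 0 # u) (hd v # 0 # v) = run u v"
proof -
  obtain c u' where u: "u = c # u'" using words_not_Nil[OF assms(1)] by (cases u) auto
  obtain d v' where v: "v = d # v'" using words_not_Nil[OF assms(2)] by (cases v) auto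
  have "c = 0 \<or> c = 1" "d = 0 \<or> d = 1" using assms by (auto simp: u v words_def)
  then have "fib_step (fib_step (fib_step 16 (c, d)) (0, 0)) (c, d) = fib_step 16 (c, d)"
    by (auto simp: fib_step_def[of 12] fib_step_def[of 6] fib_step_def[of 8] fib_step_def[of "Suc 0"]
      fib_step_def[of 11] fib_step_def[of 13] fib_step_def[of 14] width_def height_def entry_def phi_def)
  then show ?thesis by (simp add: run_def u v)
qed

text \<open>The representations padded to length \<open>2 * k + 1\<close> address \<open>p\<close>
  in the iterate of order \<open>2 * k\<close>; by \<open>run_pad2\<close> the state does not depend
  on \<open>k\<close>, and the least common length gives \<open>rep_F2 p\<close>.\<close>

lemma iterate_rep_F2:
  assumes "2 * k + 1 \<ge> length (rep_F (fst p))" "2 * k + 1 \<ge> length (rep_F (snd p))"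
  shows "iterate (2 * k) p = Some (dfao_output fib_dfao (rep_F2 p))"
proof -
  define u v where "u = rep_F (fst p)" and "v = rep_F (snd p)"
  obtain i j where i: "u \<in> words (2 * i)" and j: "v \<in> words (2 * j)"
    using rep_F(1) unfolding u_def v_def rep_words_words by metis
  have len: "length u = Suc (2 * i)" "length v = Suc (2 * j)" using i j by (auto simp: words_def)
  have pu: "pad (Suc (2 * n)) u \<in> words (2 * n)" "val_F (pad (Suc (2 * n)) u) = fst p"
    "pad (Suc (2 * Suc n)) u = hd (pad (Suc (2 * n)) u) # 0 # pad (Suc (2 * n)) u"
    if "i \<le> n" for n
    using pad_words[OF i, of "n - i"] pad_Suc[OF i, of "n - i"] rep_F(2)[of "fst p"] that
    by (simp_all add: u_def)
  have pv: "pad (Suc (2 * n)) v \<in> words (2 * n)" "val_F (pad (Suc (2 * n)) v) = snd p"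
    "pad (Suc (2 * Suc n)) v = hd (pad (Suc (2 * n)) v) # 0 # pad (Suc (2 * n)) v"
    if "j \<le> n" for n
    using pad_words[OF j, of "n - j"] pad_Suc[OF j, of "n - j"] rep_F(2)[of "snd p"] that
    by (simp_all add: v_def)
  define n where "n = max i j"
  define r where "r k = run (pad (Suc (2 * k)) u) (pad (Suc (2 * k)) v)" for k
  have "n \<le> k" using assms len by (auto simp: n_def simp flip: u_def v_def)
  then have "r k = r n"
  proof (induction k rule: dec_induct)
    case (step k)
    then have "i \<le> k" "j \<le> k" by (auto simp: n_def)
    then have "r (Suc k) = r k"
      unfolding r_def pu(3)[OF \<open>i \<le> k\<close>] pv(3)[OF \<open>j \<le> k\<close>]
      by (intro run_pad2[of _ "2 * k"] pu pv)
    with step show ?case by simp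
  qed simp
  have le: "i \<le> k" "j \<le> k" using \<open>n \<le> k\<close> by (auto simp: n_def)
  have "iterate (2 * k) p = Some (r k)"
    unfolding iterate_eq_Some r_def using pu[OF le(1)] pv[OF le(2)]
    by (metis prod.collapse)
  moreover have "rep_F2 p = zip (pad (Suc (2 * n)) u) (pad (Suc (2 * n)) v)"
  proof -
    have "max (length u) (length v) = Suc (2 * n)" by (auto simp: len n_def max_def)
    then show ?thesis by (simp add: rep_F2_def Let_def flip: u_def v_def)
  qed
  then have "foldl fib_step 16 (rep_F2 p) = r n"
    by (simp add: r_def run_def)
  \<comment> \<open>This excludes state 16, the only one that does not output itself.\<close>
  moreover have "r n \<in> H"
    using run_shape[of "pad (Suc (2 * n)) u" "2 * n" "pad (Suc (2 * n)) v"] pu(1)[of n] pv(1)[of n]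
    by (simp add: r_def n_def)
  ultimately show ?thesis
    using \<open>r k = r n\<close> by (auto simp: dfao_output_def fib_dfao_def H_def)
qed

text \<open>The iterates are eventually constant at each point, and a limit over a discrete alphabet
  is unique, so the description in \<open>x_config\<close> denotes it.\<close>

lemma x_config_eq: "x_config p = dfao_output fib_dfao (rep_F2 p)"
proof -
  define y where "y p = dfao_output fib_dfao (rep_F2 p)" for p
  have ev: "eventually (\<lambda>k. iterate (2 * k) p = Some (y p)) sequentially" for p
    unfolding y_def
    by (rule eventually_sequentiallyI[of "max (length (rep_F (fst p))) (length (rep_F (snd p)))"],
        rule iterate_rep_F2) auto
  have lim: "even_limit phi seed x \<longleftrightarrow>
      (\<forall>n. eventually (\<lambda>k. iterate (2 * k) n = Some (x n)) sequentially)" for x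
  proof -
    have "(\<forall>k. W k = iterate (2 * k)) \<longleftrightarrow> W = (\<lambda>k. iterate (2 * k))" for W by auto
    then show ?thesis unfolding even_limit_def relpowp_morph_image by simp
  qed
  have "x = y" if "even_limit phi seed x" for x
  proof
    fix n
    have "eventually (\<lambda>k. iterate (2 * k) n = Some (x n)) sequentially"
      using that unfolding lim by blast
    from eventually_conj[OF this ev[of n]] have "eventually (\<lambda>k::nat. x n = y n) sequentially"
      by (rule eventually_mono) auto
    then show "x n = y n" by simp
  qed
  then have "x_config = y"
    unfolding x_config_def using ev by (intro the_equality) (auto simp: lim)
  from fun_cong[OF this, of p] show ?thesis unfolding y_def .
qed

theorem theorem2:
  shows "\<exists>M :: (nat, nat \<times> nat, nat) dfao.
           is_dfao ({0, 1} \<times> {0, 1}) H M \<and>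
           (\<forall>n :: int \<times> int. x_config n = dfao_output M (rep_F2 n))"
  using is_dfao_fib_dfao x_config_eq by blast

end
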